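(* Consider the constrained (primal) problem $$\min_{\mathbf v\in\mathbb R^{n_v},\,\sigma\in\mathbb R^{3n_c}}\ \tfrac12\|\mathbf v-\mathbf v^*\|_{\mathbf A}^2+\tfrac12\|\sigma\|_{\mathbf R}^2\quad\text{subject to}\quad \mathbf J\mathbf v-\hat{\mathbf v}_c+\mathbf R\sigma\in\mathcal F^*,$$ and the unconstrained problem $$\min_{\mathbf v\in\mathbb R^{n_v}}\ \ell_p(\mathbf v)=\tfrac12\|\mathbf v-\mathbf v^*\|_{\mathbf A}^2+\tfrac12\|P_{\mathcal F}(\mathbf y(\mathbf v))\|_{\mathbf R}^2 .$$ If $\mathbf v$ solves the unconstrained problem, then $(\mathbf v,\sigma)$ with $\sigma=P_{\mathcal F}(\mathbf y(\mathbf v))$ solves the constrained problem.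
   Context: Let $n_v,n_c$ be positive integers. Data: $\mathbf A\in\mathbb R^{n_v\times n_v}$ symmetric positive definite; $\mathbf R\in\mathbb R^{3n_c\times 3n_c}$ diagonal with positive diagonal entries; $\mathbf J\in\mathbb R^{3n_c\times n_v}$; $\mathbf v^*\in\mathbb R^{n_v}$; $\hat{\mathbf v}_c\in\mathbb R^{3n_c}$; friction coefficients $\mu_1,\dots,\mu_{n_c}>0$. For a positive definite matrix $\mathbf X$, $\|\mathbf z\|_{\mathbf X}^2=\mathbf z^T\mathbf X\mathbf z$. The friction cone is $\mathcal F=\mathcal F_1\times\cdots\times\mathcal F_{n_c}$ with $\mathcal F_i=\{(x_t,x_n)\in\mathbb R^2\times\mathbb R:\|x_t\|\le\mu_i x_n\}$, and $\mathcal F^*=\{\mathbf z:\mathbf z^T\mathbf x\ge 0\ \forall \mathbf x\in\mathcal F\}$ is its dual cone (Euclidean inner product). Define $\mathbf y(\mathbf v)=-\mathbf R^{-1}(\mathbf J\mathbf v-\hat{\mathbf v}_c)$, and let $P_{\mathcal F}(\mathbf y)=\arg\min_{\gamma\in\mathcal F}\tfrac12(\gamma-\mathbf y)^T\mathbf R(\gamma-\mathbf y)$ be the projection onto $\mathcal F$ in the norm $\|\cdot\|_{\mathbf R}$. *)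

theory Defs
  imports "HOL-Analysis.Analysis"
begin

definition sym_pos_def :: "real ^ 'n ^ 'n \<Rightarrow> bool" where
  "sym_pos_def X \<longleftrightarrow> transpose X = X \<and> (\<forall>z. z \<noteq> 0 \<longrightarrow> 0 < z \<bullet> (X *v z))"

definition pos_diagonal :: "real ^ 'n ^ 'n \<Rightarrow> bool" where
  "pos_diagonal X \<longleftrightarrow> (\<forall>i j. i \<noteq> j \<longrightarrow> X $ i $ j = 0) \<and> (\<forall>i. 0 < X $ i $ i)"

definition sqnorm :: "real ^ 'n ^ 'n \<Rightarrow> real ^ 'n \<Rightarrow> real" where
  "sqnorm X z = z \<bullet> (X *v z)"

definition contact_cone :: "real \<Rightarrow> ((real ^ 2) \<times> real) set" where
  "contact_cone m = {(xt, xn). norm xt \<le> m * xn}"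

(* A vector of dimension 3 * n_c is indexed by pairs (i, k): i is the contact,
   k = 1, 2 are its tangential components and k = 3 is its normal component. *)

definition contact_block :: "real ^ ('c::finite \<times> 3) \<Rightarrow> 'c \<Rightarrow> (real ^ 2) \<times> real" where
  "contact_block x i = (vector [x $ (i, 1), x $ (i, 2)], x $ (i, 3))"

definition friction_cone :: "('c::finite \<Rightarrow> real) \<Rightarrow> (real ^ ('c \<times> 3)) set" where
  "friction_cone \<mu> = {x. \<forall>i. contact_block x i \<in> contact_cone (\<mu> i)}"

definition dual_cone :: "(real ^ 'n) set \<Rightarrow> (real ^ 'n) set" where
  "dual_cone C = {z. \<forall>x\<in>C. 0 \<le> z \<bullet> x}"

(* For R diagonal with positive entries the minimiser exists and is unique, so the choice
   made by arg_min is immaterial. *)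

definition proj_cone ::
    "real ^ ('c::finite \<times> 3) ^ ('c \<times> 3) \<Rightarrow> ('c \<Rightarrow> real) \<Rightarrow> real ^ ('c \<times> 3) \<Rightarrow> real ^ ('c \<times> 3)" where
  "proj_cone R \<mu> y =
     arg_min_on (\<lambda>\<gamma>. 1 / 2 * sqnorm R (\<gamma> - y)) (friction_cone \<mu>)"

definition y_map ::
    "real ^ ('c::finite \<times> 3) ^ ('c \<times> 3) \<Rightarrow> real ^ 'v ^ ('c \<times> 3) \<Rightarrow> real ^ ('c \<times> 3) \<Rightarrow> real ^ 'v
      \<Rightarrow> real ^ ('c \<times> 3)" where
  "y_map R J vc v = - (matrix_inv R *v (J *v v - vc))"

definition primal_objective ::
    "real ^ 'v ^ 'v \<Rightarrow> real ^ ('c::finite \<times> 3) ^ ('c \<times> 3) \<Rightarrow> real ^ 'v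
      \<Rightarrow> (real ^ 'v) \<times> (real ^ ('c \<times> 3)) \<Rightarrow> real" where
  "primal_objective A R vs = (\<lambda>(v, \<sigma>). 1 / 2 * sqnorm A (v - vs) + 1 / 2 * sqnorm R \<sigma>)"

definition primal_feasible ::
    "real ^ ('c::finite \<times> 3) ^ ('c \<times> 3) \<Rightarrow> real ^ 'v ^ ('c \<times> 3) \<Rightarrow> real ^ ('c \<times> 3) \<Rightarrow> ('c \<Rightarrow> real)
      \<Rightarrow> (real ^ 'v) \<times> (real ^ ('c \<times> 3)) \<Rightarrow> bool" where
  "primal_feasible R J vc \<mu> = (\<lambda>(v, \<sigma>). J *v v - vc + R *v \<sigma> \<in> dual_cone (friction_cone \<mu>))"

definition unconstrained_objective ::
    "real ^ 'v ^ 'v \<Rightarrow> real ^ ('c::finite \<times> 3) ^ ('c \<times> 3) \<Rightarrow> real ^ 'v ^ ('c \<times> 3) \<Rightarrow> real ^ 'v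
      \<Rightarrow> real ^ ('c \<times> 3) \<Rightarrow> ('c \<Rightarrow> real) \<Rightarrow> real ^ 'v \<Rightarrow> real" where
  "unconstrained_objective A R J vs vc \<mu> v =
     1 / 2 * sqnorm A (v - vs) + 1 / 2 * sqnorm R (proj_cone R \<mu> (y_map R J vc v))"

end

(* Write F for the friction cone, y for y_map R J vc v and P for the R-projection of y onto F.
   Since J v - vc = - R y, a pair (v, s) is feasible iff R (s - y) lies in the dual cone of F.
   The projection P satisfies this and is R-orthogonal to P - y, so every feasible s has
   P . R s >= P . R P, and completing the square gives ||s||_R >= ||P||_R. Hence P is the best
   slack for given v, and the unconstrained problem is the primal one minimised over the slack. *)
theory Submission
  imports Defs
begin

lemma pos_diagonal_mult_vec:
  assumes "pos_diagonal X"
  shows "(X *v z) $ i = X $ i $ i * z $ i"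
proof -
  have "(X *v z) $ i = (\<Sum>j\<in>UNIV. X $ i $ j * z $ j)"
    by (simp add: matrix_vector_mult_def)
  also have "\<dots> = (\<Sum>j\<in>UNIV. if j = i then X $ i $ i * z $ i else 0)"
    using assms by (intro sum.cong) (auto simp: pos_diagonal_def)
  finally show ?thesis by simp
qed

lemma pos_diagonal_inner_symmetric:
  assumes "pos_diagonal X"
  shows "a \<bullet> (X *v b) = b \<bullet> (X *v a)"
  by (simp add: inner_vec_def pos_diagonal_mult_vec[OF assms] mult_ac)

lemma pos_diagonal_sqnorm_nonneg:
  assumes "pos_diagonal X"
  shows "0 \<le> sqnorm X z"
proof -
  have "0 \<le> X $ i $ i" for i
    using assms by (simp add: pos_diagonal_def less_imp_le)
  then show ?thesis
    by (simp add: sqnorm_def inner_vec_def pos_diagonal_mult_vec[OF assms]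
        mult.left_commute[of "z $ _"] sum_nonneg)
qed

text \<open>Symmetry of the form merges the two cross terms. Small \<open>t\<close> yields a
  first-order condition, \<open>t = 1\<close> completes the square.\<close>

lemma pos_diagonal_sqnorm_add_scaleR:
  assumes "pos_diagonal X"
  shows "sqnorm X (a + t *\<^sub>R b) = sqnorm X a + 2 * t * (b \<bullet> (X *v a)) + t\<^sup>2 * sqnorm X b"
  using pos_diagonal_inner_symmetric[OF assms, of a b]
  by (simp add: sqnorm_def matrix_vector_right_distrib matrix_vector_mult_scaleR
      inner_add_left inner_add_right power2_eq_square algebra_simps)

text \<open>\<open>matrix_inv\<close> is a choice, so invertibility must come first: no diagonal
  entry vanishes, hence the kernel of the square matrix \<open>X\<close> is trivial.\<close>

lemma pos_diagonal_mult_matrix_inv: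
  assumes "pos_diagonal X"
  shows "X *v (matrix_inv X *v z) = z"
proof -
  have "x = 0" if "X *v x = 0" for x
  proof (rule vec_eq_iff[THEN iffD2], rule allI)
    fix i
    have "X $ i $ i * x $ i = 0"
      using that pos_diagonal_mult_vec[OF assms, of x i] by simp
    then show "x $ i = 0 $ i"
      using assms by (auto simp: pos_diagonal_def dest: spec[of _ i])
  qed
  then have "invertible X"
    using invertible_left_inverse matrix_left_invertible_ker by blast
  then have "X ** matrix_inv X = mat 1"
    unfolding invertible_def matrix_inv_def by (metis (mono_tags, lifting) someI_ex)
  then show ?thesis
    by (simp add: matrix_vector_mul_assoc)
qed

text \<open>Rescaling the coordinates by the square roots of the diagonal turns the \<open>X\<close>-norm into
  the Euclidean one, where closest points exist.\<close>

lemma pos_diagonal_closest_point_exists: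
  assumes X: "pos_diagonal X" and "closed C" and "C \<noteq> {}"
  shows "\<exists>p\<in>C. \<forall>x\<in>C. sqnorm X (p - y) \<le> sqnorm X (x - y)"
proof -
  define d where "d i = sqrt (X $ i $ i)" for i
  have d: "0 < d i" "d i * d i = X $ i $ i" for i
    using X by (auto simp: d_def pos_diagonal_def less_imp_le)
  define D where "D x = (\<chi> i. d i * x $ i)" for x
  define E where "E x = (\<chi> i. x $ i / d i)" for x
  have ED [simp]: "E (D x) = x" and DE [simp]: "D (E x) = x" for x
    using d(1) by (auto simp: E_def D_def vec_eq_iff less_imp_neq[symmetric])
  have cont: "continuous_on UNIV E"
    unfolding E_def using d(1) by (intro continuous_intros) (simp add: less_imp_neq[symmetric])
  have sq: "sqnorm X (x - y) = (dist (D y) (D x))\<^sup>2" for x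
  proof -
    have "(dist (D y) (D x))\<^sup>2 = (D x - D y) \<bullet> (D x - D y)"
      by (simp add: dist_norm power2_norm_eq_inner norm_minus_commute[of "D y"])
    also have "\<dots> = (\<Sum>i\<in>UNIV. (d i * d i) * ((x $ i - y $ i) * (x $ i - y $ i)))"
      by (simp add: inner_vec_def D_def algebra_simps)
    also have "\<dots> = sqnorm X (x - y)"
      by (simp add: d(2) sqnorm_def inner_vec_def pos_diagonal_mult_vec[OF X] mult_ac)
    finally show ?thesis by simp
  qed
  \<comment> \<open>The preimage under \<open>E\<close> is the image of \<open>C\<close> under the
    rescaling \<open>D\<close>; in this form closedness follows from continuity of
    \<open>E\<close>.\<close>
  have "closed (E -` C)"
    using closed_vimage[OF \<open>closed C\<close>] cont by blast
  moreover have "E -` C \<noteq> {}"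
    using \<open>C \<noteq> {}\<close> ED by (metis all_not_in_conv vimageI)
  ultimately obtain w where w: "w \<in> E -` C" "\<And>u. u \<in> E -` C \<Longrightarrow> dist (D y) w \<le> dist (D y) u"
    using distance_attains_inf by metis
  \<comment> \<open>Scaling the Euclidean minimiser \<open>w\<close> back gives the point sought,
    since \<open>D (E w) = w\<close>.\<close>
  have "sqnorm X (E w - y) \<le> sqnorm X (x - y)" if "x \<in> C" for x
    unfolding sq using w(2)[of "D x"] that by (simp add: power_mono)
  then show ?thesis
    using w(1) by auto
qed

text \<open>Divide by \<open>2 * t\<close> and let \<open>t\<close> tend to 0 from the right. This
  turns minimality along a segment into the sign of a directional derivative.\<close>

lemma linear_coeff_nonneg:
  fixes a b :: real
  assumes "\<And>t. 0 < t \<Longrightarrow> t < 1 \<Longrightarrow> 0 \<le> 2 * t * a + t\<^sup>2 * b"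
  shows "0 \<le> a"
proof (rule tendsto_lowerbound)
  show "((\<lambda>t. a + t * b / 2) \<longlongrightarrow> a) (at_right 0)"
    by (auto intro!: tendsto_eq_intros)
  have "0 \<le> a + t * b / 2" if "0 < t" "t < 1" for t
  proof -
    have "0 \<le> 2 * t * (a + t * b / 2)"
      using assms[OF that] by (simp add: power2_eq_square algebra_simps)
    with that show ?thesis
      by (simp add: zero_le_mult_iff)
  qed
  then show "\<forall>\<^sub>F t in at_right 0. 0 \<le> a + t * b / 2"
    by (auto intro!: eventually_at_rightI[of 0 1])
qed simp

text \<open>If moving from \<open>p\<close> along \<open>h\<close> stays in \<open>C\<close>, the
  derivative \<open>h \<bullet> (X *v (p - y))\<close> of half the squared distance is nonnegative.
  Directions \<open>h\<close> in \<open>C\<close> give the dual cone; \<open>h = p\<close> and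
  \<open>h = - p\<close> together give orthogonality.\<close>

lemma cone_projection_optimality:
  assumes X: "pos_diagonal X"
    and add: "\<And>a b. a \<in> C \<Longrightarrow> b \<in> C \<Longrightarrow> a + b \<in> C"
    and scale: "\<And>c a. 0 \<le> c \<Longrightarrow> a \<in> C \<Longrightarrow> c *\<^sub>R a \<in> C"
    and p: "p \<in> C" and min: "\<And>x. x \<in> C \<Longrightarrow> sqnorm X (p - y) \<le> sqnorm X (x - y)"
  shows "X *v (p - y) \<in> dual_cone C" and "p \<bullet> (X *v (p - y)) = 0"
proof -
  have dir: "0 \<le> h \<bullet> (X *v (p - y))" if "\<And>t. 0 < t \<Longrightarrow> t < 1 \<Longrightarrow> p + t *\<^sub>R h \<in> C" for h
  proof (rule linear_coeff_nonneg)
    fix t :: real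
    assume "0 < t" "t < 1"
    then show "0 \<le> 2 * t * (h \<bullet> (X *v (p - y))) + t\<^sup>2 * sqnorm X h"
      using min[OF that, of t] pos_diagonal_sqnorm_add_scaleR[OF X, of "p - y" t h]
      by (simp add: diff_add_eq)
  qed
  have ge: "0 \<le> h \<bullet> (X *v (p - y))" if "h \<in> C" for h
    using that p by (intro dir add scale) auto
  \<comment> \<open>The point is \<open>(1 - t) *\<^sub>R p\<close>, a nonnegative multiple of
    \<open>p\<close>.\<close>
  have "p + t *\<^sub>R (- p) \<in> C" if "t < 1" for t
    using scale[of "1 - t" p] p that by (simp add: algebra_simps)
  then have "0 \<le> (- p) \<bullet> (X *v (p - y))"
    by (intro dir) auto
  with ge[OF p] show "p \<bullet> (X *v (p - y)) = 0"
    by simp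
  show "X *v (p - y) \<in> dual_cone C"
    using ge by (auto simp: dual_cone_def inner_commute)
qed

text \<open>Pairing \<open>p\<close> with the dual vector \<open>X *v (s - y)\<close> and using
  orthogonality to replace \<open>y\<close> by \<open>p\<close> shows that the cross term in the
  expansion of \<open>sqnorm X s\<close> around \<open>p\<close> is nonnegative.\<close>

lemma cone_projection_least_sqnorm:
  assumes X: "pos_diagonal X" and p: "p \<in> C" and orth: "p \<bullet> (X *v (p - y)) = 0"
    and s: "X *v (s - y) \<in> dual_cone C"
  shows "sqnorm X p \<le> sqnorm X s"
proof -
  have "0 \<le> p \<bullet> (X *v (s - y))"
    using s p by (auto simp: dual_cone_def inner_commute)
  then have "0 \<le> p \<bullet> (X *v (s - p))"
    using orth by (simp add: matrix_vector_mult_diff_distrib inner_diff_right)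
  moreover have "sqnorm X s = sqnorm X p + 2 * (p \<bullet> (X *v (s - p))) + sqnorm X (s - p)"
    using pos_diagonal_sqnorm_add_scaleR[OF X, of p 1 "s - p"]
      pos_diagonal_inner_symmetric[OF X, of p "s - p"] by simp
  ultimately show ?thesis
    using pos_diagonal_sqnorm_nonneg[OF X, of "s - p"] by linarith
qed

text \<open>The friction cone is an intersection of preimages under these maps, so it inherits
  closedness and the cone operations from \<open>contact_cone\<close>.\<close>

lemma linear_contact_block: "linear (\<lambda>x. contact_block x i)"
  by (rule linearI) (auto simp: contact_block_def vec_eq_iff forall_2 vector_2)

lemma closed_contact_cone: "closed (contact_cone m)"
proof -
  have "contact_cone m = {z. norm (fst z) \<le> m * snd z}"
    by (auto simp: contact_cone_def)
  then show ?thesis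
    by (auto intro!: closed_Collect_le continuous_intros)
qed

lemma contact_cone_add: "a \<in> contact_cone m \<Longrightarrow> b \<in> contact_cone m \<Longrightarrow> a + b \<in> contact_cone m"
  by (auto simp: contact_cone_def distrib_left intro: norm_triangle_mono)

lemma contact_cone_scaleR: "0 \<le> c \<Longrightarrow> a \<in> contact_cone m \<Longrightarrow> c *\<^sub>R a \<in> contact_cone m"
  by (auto simp: contact_cone_def mult.left_commute[of m] intro!: mult_left_mono)

lemma friction_cone_add:
  "a \<in> friction_cone \<mu> \<Longrightarrow> b \<in> friction_cone \<mu> \<Longrightarrow> a + b \<in> friction_cone \<mu>"
  by (simp add: friction_cone_def linear_add[OF linear_contact_block] contact_cone_add)

lemma friction_cone_scaleR:
  "0 \<le> c \<Longrightarrow> a \<in> friction_cone \<mu> \<Longrightarrow> c *\<^sub>R a \<in> friction_cone \<mu>"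
  by (simp add: friction_cone_def linear_cmul[OF linear_contact_block] contact_cone_scaleR)

lemma zero_in_friction_cone: "0 \<in> friction_cone \<mu>"
  by (simp add: friction_cone_def linear_0[OF linear_contact_block] contact_cone_def zero_prod_def)

lemma closed_friction_cone: "closed (friction_cone \<mu>)"
proof -
  have "friction_cone \<mu> = (\<Inter>i. (\<lambda>x. contact_block x i) -` contact_cone (\<mu> i))"
    by (auto simp: friction_cone_def)
  moreover have "closed ((\<lambda>x. contact_block x i) -` contact_cone (\<mu> i))" for i
    by (intro closed_vimage closed_contact_cone linear_continuous_on
        linear_conv_bounded_linear[THEN iffD1] linear_contact_block)
  ultimately show ?thesis
    by auto
qed

text \<open>The choice behind \<open>arg_min_on\<close> returns a minimiser once one exists; the
  cone is closed and contains 0, which provides one.\<close>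

lemma proj_cone_closest:
  assumes R: "pos_diagonal R"
  shows "proj_cone R \<mu> y \<in> friction_cone \<mu>"
    and "x \<in> friction_cone \<mu> \<Longrightarrow> sqnorm R (proj_cone R \<mu> y - y) \<le> sqnorm R (x - y)"
proof -
  let ?f = "\<lambda>\<gamma>. 1 / 2 * sqnorm R (\<gamma> - y)"
  obtain p where p: "p \<in> friction_cone \<mu>"
    "\<And>x. x \<in> friction_cone \<mu> \<Longrightarrow> sqnorm R (p - y) \<le> sqnorm R (x - y)"
    using pos_diagonal_closest_point_exists[OF R closed_friction_cone, of \<mu> y] zero_in_friction_cone
    by blast
  then have "is_arg_min ?f (\<lambda>x. x \<in> friction_cone \<mu>) p"
    by (auto simp: is_arg_min_linorder)
  then have "is_arg_min ?f (\<lambda>x. x \<in> friction_cone \<mu>) (proj_cone R \<mu> y)"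
    unfolding proj_cone_def arg_min_on_def arg_min_def by (rule someI)
  then show "proj_cone R \<mu> y \<in> friction_cone \<mu>"
    and "x \<in> friction_cone \<mu> \<Longrightarrow> sqnorm R (proj_cone R \<mu> y - y) \<le> sqnorm R (x - y)"
    by (auto simp: is_arg_min_linorder)
qed

lemma primal_feasible_iff:
  assumes "pos_diagonal R"
  shows "primal_feasible R J vc \<mu> (v, \<sigma>) \<longleftrightarrow>
    R *v (\<sigma> - y_map R J vc v) \<in> dual_cone (friction_cone \<mu>)"
proof -
  have "R *v y_map R J vc v = - (J *v v - vc)"
    using linear_neg[OF matrix_vector_mul_linear, of R]
    by (simp add: y_map_def pos_diagonal_mult_matrix_inv[OF assms])
  then have "R *v (\<sigma> - y_map R J vc v) = J *v v - vc + R *v \<sigma>"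
    by (simp add: matrix_vector_mult_diff_distrib)
  then show ?thesis
    by (simp add: primal_feasible_def)
qed

theorem theorem2:
  fixes A :: "real ^ 'v ^ 'v"
    and R :: "real ^ ('c::finite \<times> 3) ^ ('c \<times> 3)"
    and J :: "real ^ 'v ^ ('c \<times> 3)"
    and vs :: "real ^ 'v"
    and vc :: "real ^ ('c \<times> 3)"
    and \<mu> :: "'c \<Rightarrow> real"
    and v :: "real ^ 'v"
  assumes "sym_pos_def A"
    and "pos_diagonal R"
    and "\<And>i. 0 < \<mu> i"
    and "is_arg_min (unconstrained_objective A R J vs vc \<mu>) (\<lambda>_. True) v"
  shows "is_arg_min (primal_objective A R vs) (primal_feasible R J vc \<mu>)
           (v, proj_cone R \<mu> (y_map R J vc v))"
proof -
  let ?P = "\<lambda>w. proj_cone R \<mu> (y_map R J vc w)"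
  note R = \<open>pos_diagonal R\<close>
  note opt = cone_projection_optimality[OF R friction_cone_add friction_cone_scaleR
      proj_cone_closest[OF R]]
  have feas: "primal_feasible R J vc \<mu> (w, ?P w)" for w
    using opt(1) by (simp add: primal_feasible_iff[OF R])
  have unc: "unconstrained_objective A R J vs vc \<mu> w = primal_objective A R vs (w, ?P w)" for w
    by (simp add: unconstrained_objective_def primal_objective_def)
  have "primal_objective A R vs (v, ?P v) \<le> primal_objective A R vs (w, s)"
    if "primal_feasible R J vc \<mu> (w, s)" for w s
  proof -
    \<comment> \<open>The comparison has two stages: first \<open>v\<close> against
      \<open>w\<close>, each with its projected slack, then at fixed \<open>w\<close> the projected
      slack against \<open>s\<close>.\<close>
    have "primal_objective A R vs (v, ?P v) \<le> primal_objective A R vs (w, ?P w)"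
      using assms(4) by (simp add: is_arg_min_linorder unc)
    also have "\<dots> \<le> primal_objective A R vs (w, s)"
      using cone_projection_least_sqnorm[OF R proj_cone_closest(1)[OF R] opt(2)] that
      by (simp add: primal_objective_def primal_feasible_iff[OF R])
    finally show ?thesis .
  qed
  with feas show ?thesis
    by (auto simp: is_arg_min_linorder)
qed

end
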